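(* Let $\mathcal I=\{x\in\mathbb R^n : Gx\le g\}$ be a compact convex polytope, with $G\in\mathbb R^{n_g\times n}$ and $g\in\mathbb R^{n_g}$, that is feasible robust controlled invariant for the uncertain system $x_{k+1}=Ax_k+Bu_k+Dp_k$ with constraints $x_k\in\mathcal X$, $u_k\in\mathcal U$, $p_k\in\mathcal P(x_k,u_k)$. Let $N\ge 1$ be an integer and, for $x\in\mathcal I$, let $\mathrm{MPC}_N(x)$ denote the robust model predictive control optimization problem with current state $x_k=x$ and target polytope $\mathcal I$ (all as defined in the context). Then $\mathrm{MPC}_N$ is recursively feasible if and only if $\mathrm{MPC}_N(v)$ is feasible for every vertex $v$ of $\mathcal I$.
   Context: System. $A\in\mathbb R^{n\times n}$, $B\in\mathbb R^{n\times m}$, $D\in\mathbb R^{n\times d}$ are constant matrices, and $x_{k+1}=Ax_k+Bu_k+Dp_k$ for $k=0,1,2,\dots$, where $x_k\in\mathbb R^n$ is the state, $u_k\in\mathbb R^m$ the input and $p_k\in\mathbb R^d$ the uncertainty. Constraints. $\mathcal X=\{x\in\mathbb R^n : Fx\le f\}$ and $\mathcal U=\{u\in\mathbb R^m : Hu\le h\}$ are compact convex polytopes. All vector inequalities are componentwise. Uncertainty set. For $x\in\mathbb R^n$, $u\in\mathbb R^m$, $$\mathcal P(x,u)=\Big\{Ww+\sum_{i=1}^{n_q}L_iq_i\in\mathbb R^d : Rw\le r,\ \|q_i\|_{p_{q,i}}\le\phi_i\big(\|F_{x,i}x\|_{p_{x,i}},\|F_{u,i}u\|_{p_{u,i}}\big),\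 i=1,\dots,n_q\Big\},$$ where $W,R,r,L_i,F_{x,i},F_{u,i}$ are fixed matrices/vectors of compatible dimensions, $p_{q,i},p_{x,i},p_{u,i}\in[1,\infty]$ are norm indices, and each $\phi_i:\mathbb R_+\times\mathbb R_+\to\mathbb R_+$ is convex and non-decreasing (in each argument). It is assumed that $\mathcal P(x,u)$ is (nonempty and) compact for all $x\in\mathcal X$, $u\in\mathcal U$. Write $\mathcal W=\{Ww : Rw\le r\}$. Feasible robust controlled invariance (fRCI). A compact convex set $\mathcal I$ is fRCI for this system and these constraints if $$\mathcal I=\{x\in\mathcal X : \exists u\in\mathcal U \text{ such that } Ax+Bu+Dp\in\mathcal I\ \text{ for all } p\in\mathcal P(x,u)\}.$$ Notation. $G_j^{\mathsf T}$ is the $j$-th row of $G$. For a set $\mathcal S$ and a vector $v$, $\sigma_{\mathcal S}(v)=\max_{z\in\mathcal S}v^{\mathsf T}z$, and $M\mathcal S=\{Mz : z\in\mathcal S\}$. For $t\in\{1,\dots,N\}$ and $i\in\{0,\dots,t-1\}$, $B^A_i=A^{t-1-i}B$ and $D^A_i=A^{t-1-i}D$ (dependence on $t$ suppressed). $q_{q,l}$ is the dual exponent of $p_{q,l}$: $1/q_{q,l}+1/p_{q,l}=1$. Given a current state $x_k$ and inputs $u_k,\dots,u_{k+N-1}$, the nominal states are $\bar x_k=x_k$ and $\bar x_{k+t}=A^tx_k+\sum_{i=0}^{t-1}B^A_iu_{k+i}$ for $t=1,\dots,N$. Optimization problem. $\mathrm{MPC}_N(x)$, with $x_k=x$, is: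 minimize $J(\bar x_{k+1},\dots,\bar x_{k+N},u_k,\dots,u_{k+N-1})$ over $u_k,\dots,u_{k+N-1}$, where $J:(\mathbb R^n)^N\times(\mathbb R^m)^N\to\mathbb R$ is a given convex function, subject to $u_{k+i}\in\mathcal U$ for $i=0,\dots,N-1$ and, for all $j=1,\dots,n_g$ and $t=1,\dots,N$, $$G_j^{\mathsf T}\bar x_{k+t}+\sum_{i=0}^{t-1}\sigma_{D^A_i\mathcal W}(G_j)+\sum_{i=0}^{t-1}\sum_{l=1}^{n_q}\|G_j^{\mathsf T}D^A_iL_l\|_{q_{q,l}}\,\phi_l\big(\|F_{x,l}\bar x_{k+i}\|_{p_{x,l}},\|F_{u,l}u_{k+i}\|_{p_{u,l}}\big)\le g_j .$$ The problem is feasible if its constraint set is nonempty. Recursive feasibility. The problem is implemented in receding horizon fashion: at each time $k$ one solves $\mathrm{MPC}_N(x_k)$ and applies the first input $u_k$ of an optimal solution. $\mathrm{MPC}_N$ is recursively feasible if, for every $x_0\in\mathcal I$, $\mathrm{MPC}_N(x_k)$ is feasible at every time $k\ge 0$ along every closed-loop trajectory so generated, for every uncertainty realization $p_k\in\mathcal P(x_k,u_k)$. *)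

theory Defs
  imports "HOL-Analysis.Analysis"
begin

section \<open>Norms with an exponent in \<open>[1,\<infinity>]\<close>\<close>

text \<open>The \<open>p\<close>-norm of the vector \<open>(v 0, \<dots>, v (k - 1))\<close>. The dimension \<open>k\<close> is an explicit argument
  because it varies with the index of the uncertainty component. The inserted \<open>0\<close> only matters
  for \<open>k = 0\<close>.\<close>

definition lp_norm :: "ennreal \<Rightarrow> nat \<Rightarrow> (nat \<Rightarrow> real) \<Rightarrow> real" where
  "lp_norm p k v =
     (if p = \<infinity> then Max (insert 0 ((\<lambda>i. \<bar>v i\<bar>) ` {..<k}))
      else (\<Sum>i<k. \<bar>v i\<bar> powr enn2real p) powr (1 / enn2real p))"

text \<open>In \<^typ>\<open>ennreal\<close> we have \<open>1 / \<infinity> = 0\<close> and \<open>1 / 0 = \<infinity>\<close>, so that \<open>1\<close> and \<open>\<infinity>\<close> are dual to each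
  other.\<close>

definition dual_exponent :: "ennreal \<Rightarrow> ennreal" where
  "dual_exponent p = (THE q. 1 / q + 1 / p = 1)"

lemma dual_exponent_eqI:
  assumes "1 / q + 1 / p = 1"
  shows "dual_exponent p = q"
  unfolding dual_exponent_def
proof (rule the_equality)
  fix q' :: ennreal
  assume "1 / q' + 1 / p = 1"
  then have "1 / q' = 1 / q"
    using assms by (metis ennreal_add_diff_cancel_right ennreal_add_eq_top ennreal_one_neq_top)
  then show "q' = q"
    by (metis one_divide_one_divide_ennreal)
qed (fact assms)

lemma dual_exponent:
  assumes "1 \<le> p"
  shows "1 / dual_exponent p + 1 / p = 1"
proof -
  have "1 / p \<le> 1"
  proof (cases "p = top")
    case False
    moreover have "p \<noteq> 0" using assms by auto
    ultimately show ?thesis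
      using divide_right_mono_ennreal[OF assms, of p] by (simp add: less_top)
  qed simp
  then have "1 / (1 / (1 - 1 / p)) + 1 / p = 1"
    by (simp only: one_divide_one_divide_ennreal diff_add_cancel_ennreal)
  then show ?thesis
    using dual_exponent_eqI by metis
qed


section \<open>The uncertain system\<close>

text \<open>On the type of square matrices, the operator \<open>^\<close> is the componentwise power.\<close>

definition mat_pow :: "real^'n^'n \<Rightarrow> nat \<Rightarrow> real^'n^'n" where
  "mat_pow M t = (((**) M) ^^ t) (mat 1)"

text \<open>
  The matrices \<open>L\<^sub>l\<close>, \<open>F\<^bsub>x,l\<^esub>\<close> and \<open>F\<^bsub>u,l\<^esub>\<close>, for \<open>l < num_q\<close>, have dimensions depending on \<open>l\<close>:
  \<^item> \<open>L\<^sub>l\<close> has the \<open>q_dim l\<close> columns \<open>L_col l 0, L_col l 1, \<dots>\<close> (vectors of \<open>\<real>\<^sup>d\<close>);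
  \<^item> \<open>F\<^bsub>x,l\<^esub>\<close> has the \<open>Fx_dim l\<close> rows \<open>Fx_row l 0, Fx_row l 1, \<dots>\<close> (vectors of \<open>\<real>\<^sup>n\<close>);
  \<^item> \<open>F\<^bsub>u,l\<^esub>\<close> has the \<open>Fu_dim l\<close> rows \<open>Fu_row l 0, Fu_row l 1, \<dots>\<close> (vectors of \<open>\<real>\<^sup>m\<close>).
\<close>

record ('n, 'm, 'd, 'w, 'r) usystem =
  A_mat :: "real^'n^'n"
  B_mat :: "real^'m^'n"
  D_mat :: "real^'d^'n"
  W_mat :: "real^'w^'d"
  R_mat :: "real^'w^'r"
  r_vec :: "real^'r"
  num_q :: nat
  q_dim :: "nat \<Rightarrow> nat"
  L_col :: "nat \<Rightarrow> nat \<Rightarrow> real^'d"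
  Fx_dim :: "nat \<Rightarrow> nat"
  Fx_row :: "nat \<Rightarrow> nat \<Rightarrow> real^'n"
  Fu_dim :: "nat \<Rightarrow> nat"
  Fu_row :: "nat \<Rightarrow> nat \<Rightarrow> real^'m"
  p_q :: "nat \<Rightarrow> ennreal"
  p_x :: "nat \<Rightarrow> ennreal"
  p_u :: "nat \<Rightarrow> ennreal"
  phi :: "nat \<Rightarrow> real \<Rightarrow> real \<Rightarrow> real"

text \<open>The norm indices lie in \<open>[1,\<infinity>]\<close>, and each \<open>phi l\<close>, regarded as a function on pairs of
  nonnegative reals, is nonnegative, convex, and non-decreasing in each argument.\<close>

definition admissible :: "('n::finite, 'm::finite, 'd::finite, 'w::finite, 'r::finite) usystem \<Rightarrow> bool" where
  "admissible S \<longleftrightarrow>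
     (\<forall>l<num_q S.
        1 \<le> p_q S l \<and> 1 \<le> p_x S l \<and> 1 \<le> p_u S l \<and>
        (\<forall>a\<ge>0. \<forall>b\<ge>0. 0 \<le> phi S l a b) \<and>
        convex_on ({0..} \<times> {0..}) (\<lambda>(a, b). phi S l a b) \<and>
        (\<forall>b\<ge>0. mono_on {0..} (\<lambda>a. phi S l a b)) \<and>
        (\<forall>a\<ge>0. mono_on {0..} (\<lambda>b. phi S l a b)))"

definition next_state ::
  "('n::finite, 'm::finite, 'd::finite, 'w::finite, 'r::finite) usystem \<Rightarrow>
     real^'n \<Rightarrow> real^'m \<Rightarrow> real^'d \<Rightarrow> real^'n" where
  "next_state S x u p = A_mat S *v x + B_mat S *v u + D_mat S *v p"

text \<open>The bound \<open>\<phi>\<^sub>l(\<parallel>F\<^bsub>x,l\<^esub>x\<parallel>, \<parallel>F\<^bsub>u,l\<^esub>u\<parallel>)\<close>.\<close>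

definition q_bound ::
  "('n::finite, 'm::finite, 'd::finite, 'w::finite, 'r::finite) usystem \<Rightarrow>
     nat \<Rightarrow> real^'n \<Rightarrow> real^'m \<Rightarrow> real" where
  "q_bound S l x u =
     phi S l (lp_norm (p_x S l) (Fx_dim S l) (\<lambda>i. Fx_row S l i \<bullet> x))
             (lp_norm (p_u S l) (Fu_dim S l) (\<lambda>i. Fu_row S l i \<bullet> u))"

definition uncertainty_set ::
  "('n::finite, 'm::finite, 'd::finite, 'w::finite, 'r::finite) usystem \<Rightarrow>
     real^'n \<Rightarrow> real^'m \<Rightarrow> (real^'d) set" where
  "uncertainty_set S x u =
     {W_mat S *v w + (\<Sum>l<num_q S. \<Sum>c<q_dim S l. q l c *\<^sub>R L_col S l c) | w q.
        R_mat S *v w \<le> r_vec S \<and>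
        (\<forall>l<num_q S. lp_norm (p_q S l) (q_dim S l) (q l) \<le> q_bound S l x u)}"

definition W_set ::
  "('n::finite, 'm::finite, 'd::finite, 'w::finite, 'r::finite) usystem \<Rightarrow> (real^'d) set" where
  "W_set S = {W_mat S *v w | w. R_mat S *v w \<le> r_vec S}"

definition fRCI ::
  "('n::finite, 'm::finite, 'd::finite, 'w::finite, 'r::finite) usystem \<Rightarrow>
     (real^'n) set \<Rightarrow> (real^'m) set \<Rightarrow> (real^'n) set \<Rightarrow> bool" where
  "fRCI S X U I \<longleftrightarrow>
     compact I \<and> convex I \<and>
     I = {x \<in> X. \<exists>u\<in>U. \<forall>p\<in>uncertainty_set S x u. next_state S x u p \<in> I}"


section \<open>The robust model predictive control problem\<close>

text \<open>The supremum is a maximum when \<open>Z\<close> is nonempty and compact, which is the only case of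
  interest.\<close>

definition support_fun :: "(real^'n) set \<Rightarrow> real^'n \<Rightarrow> real" where
  "support_fun Z v = (SUP z\<in>Z. v \<bullet> z)"

text \<open>An input sequence is a list of length \<open>N\<close>, whose entry \<open>us ! i\<close> is the input at time \<open>k + i\<close>.
  The state \<open>nominal S x us t\<close> is the nominal state at time \<open>k + t\<close>; it equals \<open>x\<close> for \<open>t = 0\<close>.\<close>

definition nominal ::
  "('n::finite, 'm::finite, 'd::finite, 'w::finite, 'r::finite) usystem \<Rightarrow>
     real^'n \<Rightarrow> (real^'m) list \<Rightarrow> nat \<Rightarrow> real^'n" where
  "nominal S x us t =
     mat_pow (A_mat S) t *v x + (\<Sum>i<t. (mat_pow (A_mat S) (t - 1 - i) ** B_mat S) *v (us ! i))"

text \<open>In the last sum, the entries of the row vector \<open>G\<^sub>j\<^sup>T D\<^sub>i\<^sup>A L\<^sub>l\<close> are the inner products of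
  \<open>G\<^sub>j\<close> with the columns of \<open>D\<^sub>i\<^sup>A L\<^sub>l\<close>.\<close>

definition MPC_constraints ::
  "('n::finite, 'm::finite, 'd::finite, 'w::finite, 'r::finite) usystem \<Rightarrow>
     (real^'m) set \<Rightarrow> real^'n^'g::finite \<Rightarrow> real^'g \<Rightarrow> nat \<Rightarrow> real^'n \<Rightarrow> (real^'m) list \<Rightarrow> bool" where
  "MPC_constraints S U G g N x us \<longleftrightarrow>
     length us = N \<and>
     (\<forall>i<N. us ! i \<in> U) \<and>
     (\<forall>j. \<forall>t\<in>{1..N}.
        let DA = (\<lambda>i. mat_pow (A_mat S) (t - 1 - i) ** D_mat S) in
        row j G \<bullet> nominal S x us t
        + (\<Sum>i<t. support_fun ((*v) (DA i) ` W_set S) (row j G))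
        + (\<Sum>i<t. \<Sum>l<num_q S.
             lp_norm (dual_exponent (p_q S l)) (q_dim S l) (\<lambda>c. row j G \<bullet> (DA i *v L_col S l c))
             * q_bound S l (nominal S x us i) (us ! i))
        \<le> g $ j)"

definition MPC_feasible ::
  "('n::finite, 'm::finite, 'd::finite, 'w::finite, 'r::finite) usystem \<Rightarrow>
     (real^'m) set \<Rightarrow> real^'n^'g::finite \<Rightarrow> real^'g \<Rightarrow> nat \<Rightarrow> real^'n \<Rightarrow> bool" where
  "MPC_feasible S U G g N x \<longleftrightarrow> (\<exists>us. MPC_constraints S U G g N x us)"

text \<open>Convexity of a cost \<open>J : (\<real>\<^sup>n)\<^sup>N \<times> (\<real>\<^sup>m)\<^sup>N \<rightarrow> \<real>\<close> on pairs of lists of length \<open>N\<close>.\<close>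

definition convex_cost ::
  "nat \<Rightarrow> ((real^'n) list \<Rightarrow> (real^'m) list \<Rightarrow> real) \<Rightarrow> bool" where
  "convex_cost N J \<longleftrightarrow>
     (\<forall>xs us ys vs. \<forall>s\<in>{0..1}.
        length xs = N \<longrightarrow> length us = N \<longrightarrow> length ys = N \<longrightarrow> length vs = N \<longrightarrow>
        J (map2 (\<lambda>a b. (1 - s) *\<^sub>R a + s *\<^sub>R b) xs ys) (map2 (\<lambda>a b. (1 - s) *\<^sub>R a + s *\<^sub>R b) us vs)
        \<le> (1 - s) * J xs us + s * J ys vs)"

definition MPC_optimal ::
  "('n::finite, 'm::finite, 'd::finite, 'w::finite, 'r::finite) usystem \<Rightarrow>
     (real^'m) set \<Rightarrow> real^'n^'g::finite \<Rightarrow> real^'g \<Rightarrow> nat \<Rightarrow>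
     ((real^'n) list \<Rightarrow> (real^'m) list \<Rightarrow> real) \<Rightarrow> real^'n \<Rightarrow> (real^'m) list \<Rightarrow> bool" where
  "MPC_optimal S U G g N J x us \<longleftrightarrow>
     is_arg_min (\<lambda>us. J (map (nominal S x us) [1..<Suc N]) us) (MPC_constraints S U G g N x) us"

text \<open>Closed-loop trajectories are considered up to an arbitrary time \<open>k\<close>, since existence of an
  infinite trajectory would presuppose feasibility at all times.\<close>

definition recursively_feasible ::
  "('n::finite, 'm::finite, 'd::finite, 'w::finite, 'r::finite) usystem \<Rightarrow>
     (real^'m) set \<Rightarrow> real^'n^'g::finite \<Rightarrow> real^'g \<Rightarrow> nat \<Rightarrow>
     ((real^'n) list \<Rightarrow> (real^'m) list \<Rightarrow> real) \<Rightarrow> bool" where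
  "recursively_feasible S U G g N J \<longleftrightarrow>
     (\<forall>(x :: nat \<Rightarrow> real^'n) (us :: nat \<Rightarrow> (real^'m) list) (p :: nat \<Rightarrow> real^'d) k.
        x 0 \<in> {z. G *v z \<le> g} \<longrightarrow>
        (\<forall>i<k. MPC_optimal S U G g N J (x i) (us i) \<and>
               p i \<in> uncertainty_set S (x i) (hd (us i)) \<and>
               x (Suc i) = next_state S (x i) (hd (us i)) (p i)) \<longrightarrow>
        MPC_feasible S U G g N (x k))"

end

theory Submission
  imports Defs
begin

text \<open>
  A state \<open>x\<close> together with an input sequence \<open>us\<close> is constrained by \<open>us ! i \<in> U\<close> and by inequalities
  whose left-hand sides are jointly convex in \<open>(x, us)\<close>: the nominal states depend linearly on
  \<open>(x, us)\<close>, the support function terms are constants, and each uncertainty term is a nonnegative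
  constant times a convex, monotone function of norms of linear functions
  (\<open>MPC_constraints_convex_comb\<close>). The set of feasible states is a projection of this convex set and
  therefore convex. If it contains the vertices of the target polytope, it contains the whole
  polytope, which is the convex hull of its vertices.

  It remains to see that the closed loop never leaves the target polytope. The constraint for
  \<open>t = 1\<close> bounds \<open>G\<^sub>j\<^sup>T\<close> times the nominal successor state plus the worst case of \<open>G\<^sub>j\<^sup>T D p\<close> over the
  uncertainty set: the support function covers the polyhedral part of \<open>p\<close>, and Hoelder's
  inequality with the dual exponent covers the norm-bounded parts. Hence the first input of
  a feasible sequence steers the state back into the polytope (\<open>next_state_mem_target\<close>). Robust
  controlled invariance places the target polytope inside the set of admissible states, where the
  uncertainty set is compact; this makes the suprema in the constraints finite.

  Conversely, a vertex is a possible initial state, and feasibility at time \<open>0\<close> is part of recursive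
  feasibility.
\<close>


section \<open>Norms with an exponent in \<open>[1,\<infinity>]\<close>\<close>

lemma ennreal_ge1_cases:
  fixes p :: ennreal
  assumes "1 \<le> p"
  obtains "p = top" | r where "p = ennreal r" "1 \<le> r"
proof (cases p)
  case (real r)
  then show ?thesis using assms that(2)[of r] by (simp flip: ennreal_1)
qed (use that in auto)

lemma lp_norm_ennreal:
  "0 \<le> r \<Longrightarrow> lp_norm (ennreal r) k v = (\<Sum>i<k. \<bar>v i\<bar> powr r) powr (1 / r)"
  by (simp add: lp_norm_def)

lemma lp_norm_top: "lp_norm top k v = Max (insert 0 ((\<lambda>i. \<bar>v i\<bar>) ` {..<k}))"
  by (simp add: lp_norm_def)

lemma lp_norm_nonneg [simp]: "0 \<le> lp_norm p k v"
  by (auto simp: lp_norm_def)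

lemma lp_norm_zero [simp]: "lp_norm p k (\<lambda>i. 0) = 0"
  by (auto simp: lp_norm_def image_constant_conv)

lemma lp_norm_cong:
  "(\<And>i. i < k \<Longrightarrow> u i = v i) \<Longrightarrow> lp_norm p k u = lp_norm p k v"
  unfolding lp_norm_def by (auto intro!: arg_cong[where f = Max] arg_cong[where f = "insert 0"] image_cong
      arg_cong[where f = "\<lambda>z. z powr _"] sum.cong)

lemma lp_norm_top_le_iff: "0 \<le> c \<Longrightarrow> lp_norm top k v \<le> c \<longleftrightarrow> (\<forall>i<k. \<bar>v i\<bar> \<le> c)"
  by (auto simp: lp_norm_top)

lemma abs_le_lp_norm_top: "i < k \<Longrightarrow> \<bar>v i\<bar> \<le> lp_norm top k v"
  using lp_norm_top_le_iff[of "lp_norm top k v" k v] by simp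

lemma sum_powr_eq_lp_norm_powr:
  assumes "1 \<le> r"
  shows "(\<Sum>i<k. \<bar>v i\<bar> powr r) = lp_norm (ennreal r) k v powr r"
  using assms by (simp add: lp_norm_ennreal powr_powr sum_nonneg)

lemma lp_norm_eq_0D:
  assumes "1 \<le> p" "lp_norm p k v = 0" "i < k"
  shows "v i = 0"
  using assms(1)
proof (cases rule: ennreal_ge1_cases)
  case 1
  then show ?thesis using abs_le_lp_norm_top[of i k v] assms by simp
next
  case (2 r)
  then have "(\<Sum>i<k. \<bar>v i\<bar> powr r) = 0"
    using sum_powr_eq_lp_norm_powr[of r v k] assms by simp
  then show ?thesis using assms(3) by (simp add: sum_nonneg_eq_0_iff)
qed

text \<open>The point \<open>0\<close> is included because the entries of a vector may vanish. There the inequality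
  reduces to \<open>c powr r \<le> c\<close> for a weight \<open>c\<close> between \<open>0\<close> and \<open>1\<close>.\<close>

lemma powr_convex_nonneg:
  fixes r :: real
  assumes "1 \<le> r"
  shows "convex_on {0..} (\<lambda>x. x powr r)"
proof (rule convex_onI)
  fix t x y :: real
  assume t: "0 < t" "t < 1" and "x \<in> {0..}" "y \<in> {0..}"
  then have xy: "0 \<le> x" "0 \<le> y" by auto
  have scale: "(c * z) powr r \<le> c * z powr r" if "0 < c" "c < 1" "0 \<le> z" for c z :: real
  proof -
    have "c powr r \<le> c powr 1" using that assms by (intro powr_mono') auto
    then show ?thesis using that by (simp add: powr_mult mult_right_mono)
  qed
  show "((1 - t) *\<^sub>R x + t *\<^sub>R y) powr r \<le> (1 - t) * x powr r + t * y powr r"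
  proof (cases "x = 0 \<or> y = 0")
    case True
    then show ?thesis using scale[of t y] scale[of "1 - t" x] t xy assms by auto
  next
    case False
    then show ?thesis
      using convex_onD[OF powr_convex[OF assms], of t x y] t xy by simp
  qed
qed (rule convex_real_interval)

text \<open>Minkowski's inequality. For a finite exponent it says that the unit ball is convex, which follows
  from convexity of \<open>t powr r\<close> summed over the entries: \<open>u + v\<close> is \<open>\<alpha> + \<beta>\<close> times the convex
  combination of the normalized vectors \<open>u / \<alpha>\<close> and \<open>v / \<beta>\<close> with weights proportional to
  their norms \<open>\<alpha>\<close> and \<open>\<beta>\<close>.\<close>

lemma lp_norm_triangle:
  assumes "1 \<le> p"
  shows "lp_norm p k (\<lambda>i. u i + v i) \<le> lp_norm p k u + lp_norm p k v"
  using assms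
proof (cases rule: ennreal_ge1_cases)
  case 1
  have "\<bar>u i + v i\<bar> \<le> lp_norm top k u + lp_norm top k v" if "i < k" for i
    using abs_le_lp_norm_top[OF that, of u] abs_le_lp_norm_top[OF that, of v] by linarith
  then show ?thesis using 1 by (simp add: lp_norm_top_le_iff)
next
  case (2 r)
  define \<alpha> \<beta> where "\<alpha> = lp_norm p k u" and "\<beta> = lp_norm p k v"
  have nn: "0 \<le> \<alpha>" "0 \<le> \<beta>" by (auto simp: \<alpha>_def \<beta>_def)
  consider "\<alpha> = 0" | "\<beta> = 0" | "0 < \<alpha>" "0 < \<beta>" using nn by linarith
  then show ?thesis
  proof cases
    case 1
    then have "lp_norm p k (\<lambda>i. u i + v i) = lp_norm p k v"
      using lp_norm_eq_0D[OF assms, of k u] by (intro lp_norm_cong) (simp add: \<alpha>_def)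
    then show ?thesis by simp
  next
    case 2
    then have "lp_norm p k (\<lambda>i. u i + v i) = lp_norm p k u"
      using lp_norm_eq_0D[OF assms, of k v] by (intro lp_norm_cong) (simp add: \<beta>_def)
    then show ?thesis by simp
  next
    case 3
    define s where "s = \<beta> / (\<alpha> + \<beta>)"
    have s: "0 \<le> s" "s \<le> 1" "1 - s = \<alpha> / (\<alpha> + \<beta>)" using 3 by (auto simp: s_def field_simps)
    have pointwise: "\<bar>u i + v i\<bar> powr r
        \<le> (\<alpha> + \<beta>) powr r * ((1 - s) * (\<bar>u i\<bar> powr r / \<alpha> powr r) + s * (\<bar>v i\<bar> powr r / \<beta> powr r))"
      for i
    proof -
      have "(\<alpha> + \<beta>) * (1 - s) = \<alpha>" "(\<alpha> + \<beta>) * s = \<beta>" using 3 by (simp_all add: s(3)) (simp add: s_def)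
      then have "(\<alpha> + \<beta>) * ((1 - s) * (\<bar>u i\<bar> / \<alpha>) + s * (\<bar>v i\<bar> / \<beta>)) = \<bar>u i\<bar> + \<bar>v i\<bar>"
        using 3 by (simp add: distrib_left del: mult.assoc flip: mult.assoc)
      then have "\<bar>u i + v i\<bar> \<le> (\<alpha> + \<beta>) * ((1 - s) * (\<bar>u i\<bar> / \<alpha>) + s * (\<bar>v i\<bar> / \<beta>))"
        using abs_triangle_ineq[of "u i" "v i"] by simp
      then have "\<bar>u i + v i\<bar> powr r \<le> ((\<alpha> + \<beta>) * ((1 - s) * (\<bar>u i\<bar> / \<alpha>) + s * (\<bar>v i\<bar> / \<beta>))) powr r"
        using 2 by (intro powr_mono2) auto
      also have "\<dots> = (\<alpha> + \<beta>) powr r * ((1 - s) * (\<bar>u i\<bar> / \<alpha>) + s * (\<bar>v i\<bar> / \<beta>)) powr r"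
        by (rule powr_mult)
      also have "((1 - s) * (\<bar>u i\<bar> / \<alpha>) + s * (\<bar>v i\<bar> / \<beta>)) powr r
          \<le> (1 - s) * (\<bar>u i\<bar> / \<alpha>) powr r + s * (\<bar>v i\<bar> / \<beta>) powr r"
        using convex_onD[OF powr_convex_nonneg[OF 2(2)], of s "\<bar>u i\<bar> / \<alpha>" "\<bar>v i\<bar> / \<beta>"] s 3 by simp
      finally show ?thesis using 3 by (simp add: powr_divide mult_left_mono)
    qed
    have normalized: "(\<Sum>i<k. \<bar>u i\<bar> powr r / \<alpha> powr r) = 1" "(\<Sum>i<k. \<bar>v i\<bar> powr r / \<beta> powr r) = 1"
      using 3 sum_powr_eq_lp_norm_powr[OF 2(2), of u k] sum_powr_eq_lp_norm_powr[OF 2(2), of v k]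
      by (simp_all add: \<alpha>_def \<beta>_def 2 flip: sum_divide_distrib)
    have "(\<Sum>i<k. \<bar>u i + v i\<bar> powr r) \<le> (\<Sum>i<k. (\<alpha> + \<beta>) powr r *
        ((1 - s) * (\<bar>u i\<bar> powr r / \<alpha> powr r) + s * (\<bar>v i\<bar> powr r / \<beta> powr r)))"
      by (intro sum_mono pointwise)
    also have "\<dots> = (\<alpha> + \<beta>) powr r"
      by (simp only: sum.distrib normalized mult_1_right flip: sum_distrib_left) simp
    finally have "(\<Sum>i<k. \<bar>u i + v i\<bar> powr r) powr (1 / r) \<le> ((\<alpha> + \<beta>) powr r) powr (1 / r)"
      using 2 by (intro powr_mono2) (auto intro: sum_nonneg)
    also have "\<dots> = \<alpha> + \<beta>" using 2 3 by (simp add: powr_powr)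
    finally show ?thesis using 2 by (simp add: lp_norm_ennreal \<alpha>_def \<beta>_def)
  qed
qed

lemma lp_norm_scale:
  assumes "1 \<le> p" "0 \<le> c"
  shows "lp_norm p k (\<lambda>i. c * v i) = c * lp_norm p k v"
  using assms(1)
proof (cases rule: ennreal_ge1_cases)
  case 1
  have "Max (insert 0 ((\<lambda>i. \<bar>c * v i\<bar>) ` {..<k})) = Max ((*) c ` insert 0 ((\<lambda>i. \<bar>v i\<bar>) ` {..<k}))"
    using assms by (simp add: abs_mult image_image)
  also have "\<dots> = c * Max (insert 0 ((\<lambda>i. \<bar>v i\<bar>) ` {..<k}))"
    using assms by (intro mono_Max_commute[symmetric]) (auto intro!: monoI mult_left_mono)
  finally show ?thesis using 1 by (simp add: lp_norm_top)
next
  case (2 r)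
  have "(\<Sum>i<k. \<bar>c * v i\<bar> powr r) = c powr r * (\<Sum>i<k. \<bar>v i\<bar> powr r)"
    using assms by (simp add: abs_mult powr_mult sum_distrib_left)
  then show ?thesis using 2 assms by (simp add: lp_norm_ennreal powr_mult powr_powr sum_nonneg)
qed

lemma lp_norm_convex_comb:
  assumes "1 \<le> p" "0 \<le> s" "s \<le> 1"
  shows "lp_norm p k (\<lambda>i. (1 - s) * u i + s * v i) \<le> (1 - s) * lp_norm p k u + s * lp_norm p k v"
  using lp_norm_triangle[OF assms(1), of k "\<lambda>i. (1 - s) * u i" "\<lambda>i. s * v i"] assms
  by (simp add: lp_norm_scale)

lemma dual_exponent_top: "dual_exponent top = 1"
  by (rule dual_exponent_eqI) simp

lemma dual_exponent_1: "dual_exponent 1 = top"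
  by (rule dual_exponent_eqI) simp

lemma dual_exponent_ennreal:
  assumes "1 < r"
  shows "dual_exponent (ennreal r) = ennreal (r / (r - 1))"
proof (rule dual_exponent_eqI)
  have inv: "1 / ennreal c = ennreal (1 / c)" if "0 < c" for c
    using that divide_ennreal[of 1 c] by simp
  have "1 / ennreal (r / (r - 1)) + 1 / ennreal r = ennreal (1 / (r / (r - 1)) + 1 / r)"
    using assms inv[of r] inv[of "r / (r - 1)"] by (simp only: ennreal_plus) simp
  also have "1 / (r / (r - 1)) + 1 / r = 1" using assms by (simp add: field_simps)
  finally show "1 / ennreal (r / (r - 1)) + 1 / ennreal r = 1" by simp
qed

lemma sum_mult_le_max_norm:
  "(\<Sum>i<k. u i * v i) \<le> lp_norm top k u * lp_norm 1 k v"
proof -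
  have "(\<Sum>i<k. u i * v i) \<le> (\<Sum>i<k. lp_norm top k u * \<bar>v i\<bar>)"
  proof (rule sum_mono)
    fix i assume "i \<in> {..<k}"
    then have "\<bar>u i\<bar> * \<bar>v i\<bar> \<le> lp_norm top k u * \<bar>v i\<bar>"
      by (intro mult_right_mono abs_le_lp_norm_top) auto
    then show "u i * v i \<le> lp_norm top k u * \<bar>v i\<bar>"
      by (metis abs_le_D1 abs_mult)
  qed
  also have "\<dots> = lp_norm top k u * lp_norm 1 k v"
    using lp_norm_ennreal[of 1 k v] by (simp add: sum_distrib_left sum_nonneg)
  finally show ?thesis .
qed

text \<open>Young's inequality, applied entrywise to \<open>u\<close> and \<open>v\<close> divided by their norms and then summed, gives
  the bound \<open>1 / r + 1 / r' = 1\<close> for the normalized vectors.\<close>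

lemma sum_mult_le_lp_norm_powr:
  assumes "1 < r" "1 < r'" "1 / r + 1 / r' = 1"
  shows "(\<Sum>i<k. u i * v i) \<le> lp_norm (ennreal r) k u * lp_norm (ennreal r') k v"
proof -
  define \<alpha> \<beta> where "\<alpha> = lp_norm (ennreal r) k u" and "\<beta> = lp_norm (ennreal r') k v"
  have r: "1 \<le> r" "1 \<le> r'" using assms by auto
  have p: "1 \<le> ennreal r" "1 \<le> ennreal r'" using assms by (simp_all flip: ennreal_1)
  have nn: "0 \<le> \<alpha>" "0 \<le> \<beta>" by (auto simp: \<alpha>_def \<beta>_def)
  show ?thesis
  proof (cases "\<alpha> = 0 \<or> \<beta> = 0")
    case True
    then have "u i * v i = 0" if "i < k" for i
      using lp_norm_eq_0D[OF p(1) _ that, of u] lp_norm_eq_0D[OF p(2) _ that, of v]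
      by (auto simp: \<alpha>_def \<beta>_def)
    then have "(\<Sum>i<k. u i * v i) = 0" by (intro sum.neutral) auto
    then show ?thesis by (simp del: mult_eq_0_iff)
  next
    case False
    then have pos: "0 < \<alpha>" "0 < \<beta>" using nn by auto
    have normalized: "(\<Sum>i<k. \<bar>u i\<bar> powr r / \<alpha> powr r) = 1" "(\<Sum>i<k. \<bar>v i\<bar> powr r' / \<beta> powr r') = 1"
      using pos sum_powr_eq_lp_norm_powr[OF r(1), of u k] sum_powr_eq_lp_norm_powr[OF r(2), of v k]
      by (simp_all add: \<alpha>_def \<beta>_def flip: sum_divide_distrib)
    have "u i * v i \<le> \<alpha> * \<beta> * ((\<bar>u i\<bar> powr r / \<alpha> powr r) / r + (\<bar>v i\<bar> powr r' / \<beta> powr r') / r')" for i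
    proof -
      have "u i * v i \<le> \<bar>u i\<bar> * \<bar>v i\<bar>" by (metis abs_le_D1 abs_mult order_refl)
      also have "\<dots> = \<alpha> * \<beta> * ((\<bar>u i\<bar> / \<alpha>) * (\<bar>v i\<bar> / \<beta>))" using pos by simp
      also have "\<dots> \<le> \<alpha> * \<beta> * ((\<bar>u i\<bar> / \<alpha>) powr r / r + (\<bar>v i\<bar> / \<beta>) powr r' / r')"
        using pos assms by (intro mult_left_mono Youngs_inequality) auto
      finally show ?thesis using pos by (simp add: powr_divide)
    qed
    then have "(\<Sum>i<k. u i * v i) \<le>
        (\<Sum>i<k. \<alpha> * \<beta> * ((\<bar>u i\<bar> powr r / \<alpha> powr r) / r + (\<bar>v i\<bar> powr r' / \<beta> powr r') / r'))"
      by (intro sum_mono)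
    also have "\<dots> = \<alpha> * \<beta> * (1 / r + 1 / r')"
      by (simp only: sum.distrib sum_divide_distrib[symmetric, of "\<lambda>i. _ i / _"] normalized
          flip: sum_distrib_left)
    finally show ?thesis using assms by (simp add: \<alpha>_def \<beta>_def)
  qed
qed

text \<open>Hoelder's inequality in the one-sided form that bounds the worst case of a linear functional
  over a ball of the \<open>p\<close>-norm.\<close>

lemma Hoelder_lp_norm:
  assumes "1 \<le> p"
  shows "(\<Sum>i<k. u i * v i) \<le> lp_norm (dual_exponent p) k u * lp_norm p k v"
  using assms
proof (cases rule: ennreal_ge1_cases)
  case 1
  then show ?thesis using sum_mult_le_max_norm[of v u k] by (simp add: dual_exponent_top mult.commute)
next
  case (2 r)
  show ?thesis
  proof (cases "r = 1")
    case True
    then show ?thesis using 2 sum_mult_le_max_norm[of u v k] by (simp add: dual_exponent_1)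
  next
    case False
    then have r: "1 < r" using 2 by simp
    then have "1 < r / (r - 1)" "1 / (r / (r - 1)) + 1 / r = 1" by (simp_all add: field_simps)
    then show ?thesis
      using sum_mult_le_lp_norm_powr[OF _ r, of "r / (r - 1)" u v k] 2 r
      by (simp add: dual_exponent_ennreal)
  qed
qed


section \<open>The feasible states form a convex set\<close>

lemma q_bound_nonneg:
  "admissible S \<Longrightarrow> l < num_q S \<Longrightarrow> 0 \<le> q_bound S l x u"
  by (simp add: admissible_def q_bound_def)

text \<open>A composition of a convex function with convex functions is convex when the outer function is
  non-decreasing in each argument; the inner functions are norms of linear functions.\<close>

lemma q_bound_convex:
  assumes "admissible S" "l < num_q S" "0 \<le> s" "s \<le> 1"
  shows "q_bound S l ((1 - s) *\<^sub>R x + s *\<^sub>R y) ((1 - s) *\<^sub>R u + s *\<^sub>R v)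
    \<le> (1 - s) * q_bound S l x u + s * q_bound S l y v"
proof -
  note adm = assms(1)[unfolded admissible_def, rule_format, OF assms(2)]
  define a where "a z = lp_norm (p_x S l) (Fx_dim S l) (\<lambda>i. Fx_row S l i \<bullet> z)" for z
  define b where "b z = lp_norm (p_u S l) (Fu_dim S l) (\<lambda>i. Fu_row S l i \<bullet> z)" for z
  have nn: "0 \<le> a z" "0 \<le> b z'" for z z' by (auto simp: a_def b_def)
  have a: "a ((1 - s) *\<^sub>R x + s *\<^sub>R y) \<le> (1 - s) * a x + s * a y"
    using lp_norm_convex_comb[of "p_x S l" s] adm assms by (simp add: a_def inner_right_distrib)
  have b: "b ((1 - s) *\<^sub>R u + s *\<^sub>R v) \<le> (1 - s) * b u + s * b v"
    using lp_norm_convex_comb[of "p_u S l" s] adm assms by (simp add: b_def inner_right_distrib)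
  have nn': "0 \<le> (1 - s) * a x + s * a y" "0 \<le> (1 - s) * b u + s * b v"
    using nn assms by simp_all
  have "phi S l (a ((1 - s) *\<^sub>R x + s *\<^sub>R y)) (b ((1 - s) *\<^sub>R u + s *\<^sub>R v))
      \<le> phi S l ((1 - s) * a x + s * a y) (b ((1 - s) *\<^sub>R u + s *\<^sub>R v))"
    using adm nn nn' by (intro mono_onD[OF _ _ _ a]) auto
  also have "\<dots> \<le> phi S l ((1 - s) * a x + s * a y) ((1 - s) * b u + s * b v)"
    using adm nn nn' by (intro mono_onD[OF _ _ _ b]) auto
  also have "\<dots> \<le> (1 - s) * phi S l (a x) (b u) + s * phi S l (a y) (b v)"
    using convex_onD[of "{0..} \<times> {0..}" "\<lambda>(a, b). phi S l a b" s "(a x, b u)" "(a y, b v)"]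
      adm nn assms by simp
  finally show ?thesis by (simp add: q_bound_def a_def b_def)
qed

lemma nominal_convex_comb:
  fixes S :: "('n::finite, 'm::finite, 'd::finite, 'w::finite, 'r::finite) usystem"
  assumes "length us = N" "length vs = N" "t \<le> N"
  shows "nominal S ((1 - s) *\<^sub>R x + s *\<^sub>R y) (map2 (\<lambda>a b. (1 - s) *\<^sub>R a + s *\<^sub>R b) us vs) t
    = (1 - s) *\<^sub>R nominal S x us t + s *\<^sub>R nominal S y vs t"
proof -
  have "(\<Sum>i<t. M i *v (map2 (\<lambda>a b. (1 - s) *\<^sub>R a + s *\<^sub>R b) us vs ! i))
    = (\<Sum>i<t. (1 - s) *\<^sub>R (M i *v (us ! i)) + s *\<^sub>R (M i *v (vs ! i)))" for M :: "nat \<Rightarrow> real^'m^'n"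
    using assms by (intro sum.cong) (auto simp: matrix_vector_right_distrib matrix_vector_mult_scaleR)
  then show ?thesis
    by (simp add: nominal_def matrix_vector_right_distrib matrix_vector_mult_scaleR sum.distrib
        scaleR_add_right ac_simps flip: scaleR_sum_right)
qed

lemma MPC_constraints_convex_comb:
  assumes "admissible S" "convex U" "0 \<le> s" "s \<le> 1"
    and x: "MPC_constraints S U G g N x us" and y: "MPC_constraints S U G g N y vs"
  shows "MPC_constraints S U G g N ((1 - s) *\<^sub>R x + s *\<^sub>R y)
    (map2 (\<lambda>a b. (1 - s) *\<^sub>R a + s *\<^sub>R b) us vs)" (is "MPC_constraints S U G g N ?z ?ws")
  unfolding MPC_constraints_def Let_def
proof (intro conjI allI impI ballI)
  have len: "length us = N" "length vs = N" using x y by (auto simp: MPC_constraints_def)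
  then show "length ?ws = N" by simp
  have ws: "?ws ! i = (1 - s) *\<^sub>R (us ! i) + s *\<^sub>R (vs ! i)" if "i < N" for i
    using that len by simp
  show "?ws ! i \<in> U" if "i < N" for i
  proof -
    have "us ! i \<in> U" "vs ! i \<in> U" using x y that by (auto simp: MPC_constraints_def)
    then show ?thesis using ws[OF that] assms convexD_alt[of U "us ! i" "vs ! i" s] by auto
  qed
  fix j t assume t: "t \<in> {1..N}"
  then have tN: "t \<le> N" by simp
  define c where "c i l = lp_norm (dual_exponent (p_q S l)) (q_dim S l)
    (\<lambda>c. row j G \<bullet> ((mat_pow (A_mat S) (t - 1 - i) ** D_mat S) *v L_col S l c))" for i l
  \<comment> \<open>The constraint is an inner product with a nominal state plus a constant \<open>C\<close> plus a sum \<open>Q\<close>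
    with nonnegative coefficients \<open>c i l\<close>; only \<open>Q\<close> is nonlinear.\<close>
  define C where "C = (\<Sum>i<t. support_fun ((*v) (mat_pow (A_mat S) (t - 1 - i) ** D_mat S) ` W_set S) (row j G))"
  define Q where "Q x us = (\<Sum>i<t. \<Sum>l<num_q S. c i l * q_bound S l (nominal S x us i) (us ! i))" for x us
  have con: "row j G \<bullet> nominal S x us t + C + Q x us \<le> g $ j"
    "row j G \<bullet> nominal S y vs t + C + Q y vs \<le> g $ j"
    using x y t by (auto simp: MPC_constraints_def Let_def C_def Q_def c_def)
  have Q: "Q ?z ?ws \<le> (1 - s) * Q x us + s * Q y vs"
  proof -
    have "Q ?z ?ws \<le> (\<Sum>i<t. \<Sum>l<num_q S.
       c i l * ((1 - s) * q_bound S l (nominal S x us i) (us ! i) + s * q_bound S l (nominal S y vs i) (vs ! i)))"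
      unfolding Q_def
    proof (intro sum_mono mult_left_mono)
      fix i l assume "i \<in> {..<t}" "l \<in> {..<num_q S}"
      then have i: "i < N" "i \<le> N" and l: "l < num_q S" using t by auto
      show "q_bound S l (nominal S ?z ?ws i) (?ws ! i)
        \<le> (1 - s) * q_bound S l (nominal S x us i) (us ! i) + s * q_bound S l (nominal S y vs i) (vs ! i)"
        unfolding nominal_convex_comb[OF len i(2)] ws[OF i(1)]
        by (rule q_bound_convex) (use assms l in auto)
    qed (simp add: c_def)
    also have "\<dots> = (1 - s) * Q x us + s * Q y vs"
      by (simp add: Q_def sum_distrib_left sum.distrib distrib_left mult.left_commute)
    finally show ?thesis .
  qed
  have "row j G \<bullet> nominal S ?z ?ws t + C + Q ?z ?ws
    \<le> (1 - s) * (row j G \<bullet> nominal S x us t + C + Q x us)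
      + s * (row j G \<bullet> nominal S y vs t + C + Q y vs)"
    unfolding nominal_convex_comb[OF len tN]
    using Q by (simp add: inner_right_distrib) (simp add: algebra_simps)
  also have "\<dots> \<le> (1 - s) * g $ j + s * g $ j"
    using con assms by (intro add_mono mult_left_mono) auto
  finally show "row j G \<bullet> nominal S ?z ?ws t
    + (\<Sum>i<t. support_fun ((*v) (mat_pow (A_mat S) (t - 1 - i) ** D_mat S) ` W_set S) (row j G))
    + (\<Sum>i<t. \<Sum>l<num_q S.
         lp_norm (dual_exponent (p_q S l)) (q_dim S l)
           (\<lambda>c. row j G \<bullet> ((mat_pow (A_mat S) (t - 1 - i) ** D_mat S) *v L_col S l c))
         * q_bound S l (nominal S ?z ?ws i) (?ws ! i)) \<le> g $ j"
    by (simp add: C_def Q_def c_def algebra_simps)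
qed

lemma convex_MPC_feasible:
  assumes "admissible S" "convex U"
  shows "convex {x. MPC_feasible S U G g N x}"
  unfolding convex_alt MPC_feasible_def
  using MPC_constraints_convex_comb[OF assms] by blast


section \<open>Feasible inputs keep the state in the target polytope\<close>

text \<open>All norm-bounded parts may vanish. Through this inclusion the polyhedral part of the uncertainty
  inherits boundedness from the uncertainty set.\<close>

lemma W_set_subset_uncertainty_set:
  assumes "admissible S"
  shows "W_set S \<subseteq> uncertainty_set S x u"
proof
  fix z assume "z \<in> W_set S"
  then obtain w where w: "z = W_mat S *v w" "R_mat S *v w \<le> r_vec S" by (auto simp: W_set_def)
  then show "z \<in> uncertainty_set S x u"
    unfolding uncertainty_set_def
    using q_bound_nonneg[OF assms]
    by (auto intro!: exI[of _ w] exI[of _ "\<lambda>l c. 0"])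
qed

lemma inner_le_support_fun:
  assumes "bounded Z" "z \<in> Z"
  shows "v \<bullet> z \<le> support_fun Z v"
  unfolding support_fun_def
proof (rule cSUP_upper[OF assms(2)])
  obtain b where "\<forall>z\<in>Z. norm z \<le> b" using assms(1) by (auto simp: bounded_iff)
  then show "bdd_above ((\<bullet>) v ` Z)"
    by (intro bdd_aboveI2[of _ _ "norm v * b"])
      (meson Cauchy_Schwarz_ineq2 abs_le_D1 mult_left_mono norm_ge_zero order_trans)
qed

text \<open>The terms added to the nominal value are upper bounds for the contributions of \<open>W w\<close> (support
  function) and of \<open>L\<^sub>l q\<^sub>l\<close> (Hoelder's inequality) to the inner product with \<open>D p\<close>.\<close>

lemma row_inner_next_state_le:
  fixes a :: "real^'n" and S :: "('n::finite, 'm::finite, 'd::finite, 'w::finite, 'r::finite) usystem"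
  assumes "admissible S" "bounded (W_set S)" "p \<in> uncertainty_set S x u"
  shows "a \<bullet> next_state S x u p \<le> a \<bullet> (A_mat S *v x + B_mat S *v u)
    + support_fun ((*v) (D_mat S) ` W_set S) a
    + (\<Sum>l<num_q S. lp_norm (dual_exponent (p_q S l)) (q_dim S l) (\<lambda>c. a \<bullet> (D_mat S *v L_col S l c))
        * q_bound S l x u)"
proof -
  obtain w q where p: "p = W_mat S *v w + (\<Sum>l<num_q S. \<Sum>c<q_dim S l. q l c *\<^sub>R L_col S l c)"
    and w: "R_mat S *v w \<le> r_vec S"
    and q: "\<And>l. l < num_q S \<Longrightarrow> lp_norm (p_q S l) (q_dim S l) (q l) \<le> q_bound S l x u"
    using assms(3) by (auto simp: uncertainty_set_def)
  have "a \<bullet> (D_mat S *v p) = a \<bullet> (D_mat S *v (W_mat S *v w))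
      + (\<Sum>l<num_q S. \<Sum>c<q_dim S l. (a \<bullet> (D_mat S *v L_col S l c)) * q l c)"
    unfolding p
    by (simp add: matrix_vector_right_distrib linear_sum[OF matrix_vector_mul_linear] inner_right_distrib inner_sum_right
        matrix_vector_mult_scaleR mult.commute)
  also have "a \<bullet> (D_mat S *v (W_mat S *v w)) \<le> support_fun ((*v) (D_mat S) ` W_set S) a"
    using w assms(2)
    by (intro inner_le_support_fun bounded_linear_image) (auto simp: W_set_def)
  also have "(\<Sum>l<num_q S. \<Sum>c<q_dim S l. (a \<bullet> (D_mat S *v L_col S l c)) * q l c)
      \<le> (\<Sum>l<num_q S. lp_norm (dual_exponent (p_q S l)) (q_dim S l) (\<lambda>c. a \<bullet> (D_mat S *v L_col S l c))
        * q_bound S l x u)"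
  proof (rule sum_mono)
    fix l assume "l \<in> {..<num_q S}"
    then have l: "l < num_q S" by simp
    then have "1 \<le> p_q S l" using assms(1) by (simp add: admissible_def)
    from Hoelder_lp_norm[OF this] q[OF l]
    show "(\<Sum>c<q_dim S l. (a \<bullet> (D_mat S *v L_col S l c)) * q l c)
      \<le> lp_norm (dual_exponent (p_q S l)) (q_dim S l) (\<lambda>c. a \<bullet> (D_mat S *v L_col S l c)) * q_bound S l x u"
      by (meson lp_norm_nonneg mult_left_mono order_trans)
  qed
  finally show ?thesis by (simp add: next_state_def inner_right_distrib)
qed

text \<open>For \<open>t = 1\<close> the powers of the state matrix are the identity, and the left-hand side of the
  constraint is exactly the preceding bound on the true successor state.\<close>

lemma next_state_mem_target:
  assumes "admissible S" "bounded (W_set S)" "1 \<le> N"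
    and con: "MPC_constraints S U G g N x us"
    and p: "p \<in> uncertainty_set S x (hd us)"
  shows "G *v next_state S x (hd us) p \<le> g"
  unfolding less_eq_vec_def
proof
  fix j
  have "us \<noteq> []" using con assms(3) by (auto simp: MPC_constraints_def)
  then have hd: "us ! 0 = hd us" by (simp add: hd_conv_nth)
  have nom: "nominal S x us 0 = x" "nominal S x us (Suc 0) = A_mat S *v x + B_mat S *v hd us"
    by (simp_all add: nominal_def mat_pow_def hd)
  have "row j G \<bullet> next_state S x (hd us) p \<le> g $ j"
    using row_inner_next_state_le[OF assms(1,2) p, of "row j G"] con[unfolded MPC_constraints_def Let_def] assms(3)
    by (elim conjE allE[of _ j] ballE[of _ _ 1]) (simp_all add: nom hd mat_pow_def)
  then show "(G *v next_state S x (hd us) p) $ j \<le> g $ j"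
    by (simp add: matrix_vector_mul_component row_def)
qed


section \<open>Recursive feasibility\<close>

theorem theorem1:
  fixes S :: "('n::finite, 'm::finite, 'd::finite, 'w::finite, 'r::finite) usystem"
    and F :: "real^'n^'f::finite" and f :: "real^'f"
    and H :: "real^'m^'h::finite" and h :: "real^'h"
    and X :: "(real^'n) set" and U :: "(real^'m) set"
    and G :: "real^'n^'g::finite" and g :: "real^'g"
    and I :: "(real^'n) set"
    and N :: nat
    and J :: "(real^'n) list \<Rightarrow> (real^'m) list \<Rightarrow> real"
  assumes "X = {x. F *v x \<le> f}" and "compact X"
    and "U = {u. H *v u \<le> h}" and "compact U"
    and "admissible S"
    and "\<And>x u. x \<in> X \<Longrightarrow> u \<in> U \<Longrightarrow> uncertainty_set S x u \<noteq> {} \<and> compact (uncertainty_set S x u)"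
    and "I = {x. G *v x \<le> g}" and "compact I"
    and "fRCI S X U I"
    and "1 \<le> N"
    and "convex_cost N J"
  shows "recursively_feasible S U G g N J \<longleftrightarrow>
         (\<forall>v. v extreme_point_of I \<longrightarrow> MPC_feasible S U G g N v)"
proof
  assume rec: "recursively_feasible S U G g N J"
  show "\<forall>v. v extreme_point_of I \<longrightarrow> MPC_feasible S U G g N v"
  proof (intro allI impI)
    fix v assume "v extreme_point_of I"
    then have "v \<in> I" by (simp add: extreme_point_of_def)
    \<comment> \<open>The closed-loop trajectory of length zero starting at \<open>v\<close>.\<close>
    then show "MPC_feasible S U G g N v"
      using rec[unfolded recursively_feasible_def, rule_format, of "\<lambda>_. v" 0] assms(7) by simp
  qed
next
  assume vertices: "\<forall>v. v extreme_point_of I \<longrightarrow> MPC_feasible S U G g N v"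
  have "convex U"
    unfolding assms(3) convex_alt
  proof (clarsimp simp: less_eq_vec_def matrix_vector_right_distrib matrix_vector_mult_scaleR)
    fix x y :: "real^'m" and s j
    assume "\<forall>j. (H *v x) $ j \<le> h $ j" "\<forall>j. (H *v y) $ j \<le> h $ j" "0 \<le> s" "s \<le> (1::real)"
    then show "(1 - s) * (H *v x) $ j + s * (H *v y) $ j \<le> h $ j"
      by (intro convex_bound_le) auto
  qed
  have "convex I" using assms(9) by (simp add: fRCI_def)
  with \<open>compact I\<close> have "I = convex hull {v. v extreme_point_of I}"
    by (rule Krein_Milman_Minkowski)
  also have "\<dots> \<subseteq> {x. MPC_feasible S U G g N x}"
    using vertices convex_MPC_feasible[OF assms(5) \<open>convex U\<close>] by (intro hull_minimal) auto
  finally have feasible: "MPC_feasible S U G g N x" if "x \<in> I" for x using that by auto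
  \<comment> \<open>A state in \<open>I\<close> lies in \<open>X\<close> and comes with an input in \<open>U\<close>, by invariance. At such a pair the
    uncertainty set is compact, and it contains \<open>W_set S\<close>.\<close>
  have bounded_W: "bounded (W_set S)" if x: "x \<in> I" for x
  proof -
    have "I \<subseteq> {x \<in> X. \<exists>u\<in>U. \<forall>p\<in>uncertainty_set S x u. next_state S x u p \<in> I}"
      using assms(9) unfolding fRCI_def by (elim conjE equalityE)
    then obtain u where "x \<in> X" "u \<in> U" using x by blast
    then have "bounded (uncertainty_set S x u)" using assms(6) compact_imp_bounded by blast
    then show ?thesis using W_set_subset_uncertainty_set[OF assms(5)] bounded_subset by blast
  qed
  show "recursively_feasible S U G g N J"
    unfolding recursively_feasible_def
  proof (intro allI impI)
    fix x :: "nat \<Rightarrow> real^'n" and us p k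
    assume x0: "x 0 \<in> {z. G *v z \<le> g}"
      and traj: "\<forall>i<k. MPC_optimal S U G g N J (x i) (us i) \<and>
        p i \<in> uncertainty_set S (x i) (hd (us i)) \<and>
        x (Suc i) = next_state S (x i) (hd (us i)) (p i)"
    have "x i \<in> I" if "i \<le> k" for i
      using that
    proof (induction i)
      case 0
      then show ?case using x0 assms(7) by simp
    next
      case (Suc i)
      then have "x i \<in> I" and "MPC_constraints S U G g N (x i) (us i)"
        and "p i \<in> uncertainty_set S (x i) (hd (us i))"
        using traj by (auto simp: MPC_optimal_def is_arg_min_def)
      then have "G *v next_state S (x i) (hd (us i)) (p i) \<le> g"
        by (intro next_state_mem_target[OF assms(5) bounded_W \<open>1 \<le> N\<close>])
      then show ?case using Suc traj assms(7) by simp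
    qed
    then show "MPC_feasible S U G g N (x k)" using feasible by simp
  qed
qed

end
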